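(* Suppose that for every $\alpha\in[0,1]$ the local test has the form $$t_\alpha(S)=\mathbf 1\Big\{\sum_{i\in S}h(T_i)\le C(|S|,\alpha)\Big\},$$ where $h$ is a monotonically increasing function. Then for every $S\subseteq[m]$, $$\overline p(S)=\max_{0\le i\le |S^c|}p\big(S\cup J_i^\star\big),$$ where $S^c=[m]\setminus S$ and $J_i^\star$ is the set of indices of the hypotheses associated with the $i$ largest scores in $S^c$. This is a linear-time expression: it can be evaluated with $O(m)$ computation.
   Context: There are $m$ hypotheses $H_1,\dots,H_m$ (each a collection of probability measures on a common measurable space), $[m]=\{1,\dots,m\}$, and each $H_i$ comes with a real-valued score $T_i$ (for example a $p$-value), small values being evidence against $H_i$. For $S\subseteq[m]$, $H_S=\bigcap_{i\in S}H_i$; $H_\emptyset$ is the set of all probability measures, hence always true and never rejected ($t_\alpha(\emptyset)=0$). A local test at level $\alpha$ assigns to each $S\subseteq[m]$ a value $t_\alpha(S)\in\{0,1\}$, where $1$ means $H_S$ is rejected. Here $C(s,\alpha)$ is a critical value depending only on the cardinality $s$ and the level $\alpha$; the family $(t_\alpha)_\alpha$ is such that for each $S$ there is a statistic $f(|S|;(T_i)_{i\in S})$ not depending on $\alpha$ with $t_\alpha(S)=\mathbf 1\{f(|S|;(T_i)_{i\in S})\le\alpha\}$ (so rejection at a level implies rejection at every larger level). Closed testing: $\overline t_\alpha(S)=\mathbf 1\{t_\alpha(J)=1\text{ for all }J\text{ with }S\subseteq J\subseteq[m]\}$. Adjusted $p$-values: $p(S)=\inf\{\alpha\in[0,1]:t_\alpha(S)=1\}$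 and $\overline p(S)=\inf\{\alpha\in[0,1]:\overline t_\alpha(S)=1\}$ (infima in $[0,1]$, so the infimum of the empty set is $1$). Ties among scores are broken arbitrarily, consistently so that $J_0^\star\subseteq J_1^\star\subseteq\cdots\subseteq J^\star_{|S^c|}$. Computation is counted for presorted scores in elementary operations, where one evaluation of $h$, and one determination of $\inf\{\alpha\in[0,1]:q\le C(s,\alpha)\}$ for given $q,s$, each count as one operation. *)

theory Defs
  imports
    "HOL-Library.FuncSet"
    "HOL-Library.Extended_Real"
    "HOL-Library.Landau_Symbols"
begin

section \<open>Closed testing and adjusted p-values\<close>

text \<open>
  The hypotheses are indexed by the set \<open>{1..m}\<close>, and \<open>T i\<close> is the observed score of the
  hypothesis with index \<open>i\<close>: everything below is pointwise in the data. A family of local tests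
  is a function \<open>t\<close>, where \<open>t \<alpha> S = 1\<close> means that the intersection hypothesis of \<open>S\<close> is
  rejected at level \<open>\<alpha>\<close>.
\<close>

definition local_tests :: "nat \<Rightarrow> (nat \<Rightarrow> real) \<Rightarrow> (real \<Rightarrow> nat set \<Rightarrow> nat) \<Rightarrow> bool" where
  "local_tests m T t \<longleftrightarrow>
     (\<forall>\<alpha>\<in>{0..1}. t \<alpha> {} = 0) \<and>
     (\<exists>f :: nat \<Rightarrow> (nat \<Rightarrow> real) \<Rightarrow> real.
        \<forall>S\<subseteq>{1..m}. \<forall>\<alpha>\<in>{0..1}. t \<alpha> S = of_bool (f (card S) (restrict T S) \<le> \<alpha>))"

text \<open>
  The empty set is exempt from the sum form, because the intersection over the empty set is never
  rejected. The set \<open>D\<close> is a range for the scores; it allows for functions such as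
  \<open>ln\<close> on \<open>{0<..1}\<close> that are not increasing (or not defined) on the whole real line. Critical
  values may be infinite, as happens for many classical tests at level 0 or 1.
\<close>

definition sum_local_tests ::
  "nat \<Rightarrow> real set \<Rightarrow> (nat \<Rightarrow> real) \<Rightarrow> (real \<Rightarrow> real) \<Rightarrow> (nat \<Rightarrow> real \<Rightarrow> ereal) \<Rightarrow>
    (real \<Rightarrow> nat set \<Rightarrow> nat) \<Rightarrow> bool" where
  "sum_local_tests m D T h C t \<longleftrightarrow>
     local_tests m T t \<and>
     (\<forall>i\<in>{1..m}. T i \<in> D) \<and>
     mono_on D h \<and>
     (\<forall>\<alpha>\<in>{0..1}. \<forall>S\<subseteq>{1..m}. S \<noteq> {} \<longrightarrow>
        t \<alpha> S = of_bool (ereal (\<Sum>i\<in>S. h (T i)) \<le> C (card S) \<alpha>))"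

definition closed_test ::
  "nat \<Rightarrow> (real \<Rightarrow> nat set \<Rightarrow> nat) \<Rightarrow> real \<Rightarrow> nat set \<Rightarrow> nat" where
  "closed_test m t \<alpha> S = of_bool (\<forall>J. S \<subseteq> J \<and> J \<subseteq> {1..m} \<longrightarrow> t \<alpha> J = 1)"

text \<open>The infimum in the complete lattice \<open>{0..1}\<close>.\<close>

definition unit_Inf :: "real set \<Rightarrow> real" where
  "unit_Inf A = (if A = {} then 1 else Inf A)"

definition adj_pvalue :: "(real \<Rightarrow> nat set \<Rightarrow> nat) \<Rightarrow> nat set \<Rightarrow> real" where
  "adj_pvalue t S = unit_Inf {\<alpha>\<in>{0..1}. t \<alpha> S = 1}"

text \<open>
  \<open>J i\<close> consists of the indices of \<open>i\<close> largest scores outside \<open>S\<close>. Ties are broken arbitrarily,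
  subject to the sets forming a chain.
\<close>

definition top_scores ::
  "nat \<Rightarrow> (nat \<Rightarrow> real) \<Rightarrow> nat set \<Rightarrow> (nat \<Rightarrow> nat set) \<Rightarrow> bool" where
  "top_scores m T S J \<longleftrightarrow>
     (\<forall>i \<le> card ({1..m} - S).
        J i \<subseteq> {1..m} - S \<and> card (J i) = i \<and>
        (\<forall>a\<in>J i. \<forall>b\<in>{1..m} - S - J i. T b \<le> T a)) \<and>
     (\<forall>i < card ({1..m} - S). J i \<subseteq> J (Suc i))"

section \<open>A machine model for counting elementary operations\<close>

text \<open>
  Programs are finite pieces of syntax over registers holding natural numbers and registers
  holding real numbers. They have read-only random access to the input: the number \<open>m\<close>
  of hypotheses, the scores, an array listing the indices in order of decreasing
  score, and the indicator array of \<open>S\<close>. The functions \<open>h_fun\<close> and \<open>crit_inf\<close> are only available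
  through single calls. Every basic instruction and every evaluation of a test takes one unit of
  time. The instruction set is deliberately small (no writable arrays, no multiplication, no
  rounding of reals): a program for this machine is also a program for the usual real RAM.
\<close>

record input =
  num_hyps :: nat
  score :: "nat \<Rightarrow> real"
  sorted_index :: "nat \<Rightarrow> nat"
  members :: "nat set"
  h_fun :: "real \<Rightarrow> real"
  crit_inf :: "nat \<Rightarrow> real \<Rightarrow> real"

record state =
  nreg :: "nat \<Rightarrow> nat"
  rreg :: "nat \<Rightarrow> real"

type_synonym reg = nat

datatype instr =
    NConst reg nat
  | NAdd reg reg reg
  | NSub reg reg reg
  | RConst reg nat
  | RAdd reg reg reg
  | RSub reg reg reg
  | ReadNum reg
  | ReadIndex reg reg
  | ReadScore reg reg
  | CallH reg reg
  | CallCrit reg reg reg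

datatype test =
    NLess reg reg
  | RLess reg reg
  | Member reg

datatype program =
    Skip
  | Do instr
  | Seq program program
  | Cond test program program
  | While test program

definition set_nreg :: "reg \<Rightarrow> nat \<Rightarrow> state \<Rightarrow> state" where
  "set_nreg x v s = s\<lparr>nreg := (nreg s)(x := v)\<rparr>"

definition set_rreg :: "reg \<Rightarrow> real \<Rightarrow> state \<Rightarrow> state" where
  "set_rreg x v s = s\<lparr>rreg := (rreg s)(x := v)\<rparr>"

fun run_instr :: "input \<Rightarrow> instr \<Rightarrow> state \<Rightarrow> state" where
  "run_instr I (NConst x k) s = set_nreg x k s"
| "run_instr I (NAdd x y z) s = set_nreg x (nreg s y + nreg s z) s"
| "run_instr I (NSub x y z) s = set_nreg x (nreg s y - nreg s z) s"
| "run_instr I (RConst x k) s = set_rreg x (real k) s"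
| "run_instr I (RAdd x y z) s = set_rreg x (rreg s y + rreg s z) s"
| "run_instr I (RSub x y z) s = set_rreg x (rreg s y - rreg s z) s"
| "run_instr I (ReadNum x) s = set_nreg x (num_hyps I) s"
| "run_instr I (ReadIndex x y) s = set_nreg x (sorted_index I (nreg s y)) s"
| "run_instr I (ReadScore x y) s = set_rreg x (score I (nreg s y)) s"
| "run_instr I (CallH x y) s = set_rreg x (h_fun I (rreg s y)) s"
| "run_instr I (CallCrit x y z) s = set_rreg x (crit_inf I (nreg s y) (rreg s z)) s"

fun run_test :: "input \<Rightarrow> test \<Rightarrow> state \<Rightarrow> bool" where
  "run_test I (NLess x y) s \<longleftrightarrow> nreg s x < nreg s y"
| "run_test I (RLess x y) s \<longleftrightarrow> rreg s x < rreg s y"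
| "run_test I (Member x) s \<longleftrightarrow> nreg s x \<in> members I"

text \<open>
  \<open>exec I c s n s'\<close>: on input \<open>I\<close>, started in state \<open>s\<close>, program \<open>c\<close> terminates after \<open>n\<close>
  elementary operations in state \<open>s'\<close>.
\<close>

inductive exec :: "input \<Rightarrow> program \<Rightarrow> state \<Rightarrow> nat \<Rightarrow> state \<Rightarrow> bool" for I where
  Skip: "exec I Skip s 1 s"
| Do: "exec I (Do i) s 1 (run_instr I i s)"
| Seq: "exec I c1 s1 n1 s2 \<Longrightarrow> exec I c2 s2 n2 s3 \<Longrightarrow> exec I (Seq c1 c2) s1 (n1 + n2) s3"
| CondTrue: "run_test I b s \<Longrightarrow> exec I c1 s n s' \<Longrightarrow> exec I (Cond b c1 c2) s (1 + n) s'"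
| CondFalse: "\<not> run_test I b s \<Longrightarrow> exec I c2 s n s' \<Longrightarrow> exec I (Cond b c1 c2) s (1 + n) s'"
| WhileFalse: "\<not> run_test I b s \<Longrightarrow> exec I (While b c) s 1 s"
| WhileTrue: "run_test I b s1 \<Longrightarrow> exec I c s1 n1 s2 \<Longrightarrow> exec I (While b c) s2 n2 s3 \<Longrightarrow>
    exec I (While b c) s1 (1 + n1 + n2) s3"

text \<open>Execution is deterministic, so the result and the running time are well defined.\<close>

lemma exec_deterministic:
  "exec I c s n s' \<Longrightarrow> exec I c s n' s'' \<Longrightarrow> n' = n \<and> s'' = s'"
proof (induction arbitrary: n' s'' rule: exec.induct)
  case (Skip s)
  then show ?case by (auto elim: exec.cases)
next
  case (Do i s)
  then show ?case by (auto elim: exec.cases)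
next
  case (Seq c1 s1 n1 s2 c2 n2 s3)
  from Seq.prems Seq.IH show ?case by cases blast
next
  case (CondTrue b s c1 n s' c2)
  from CondTrue.prems CondTrue.IH CondTrue.hyps show ?case by cases blast+
next
  case (CondFalse b s c2 n s' c1)
  from CondFalse.prems CondFalse.IH CondFalse.hyps show ?case by cases blast+
next
  case (WhileFalse b s c)
  from WhileFalse.prems WhileFalse.hyps show ?case by cases blast+
next
  case (WhileTrue b s1 c n1 s2 n2 s3)
  from WhileTrue.prems WhileTrue.IH WhileTrue.hyps show ?case by cases blast+
qed

definition computes_within :: "program \<Rightarrow> input \<Rightarrow> real \<Rightarrow> nat \<Rightarrow> bool" where
  "computes_within c I v k \<longleftrightarrow>
     (\<exists>n s. exec I c \<lparr>nreg = (\<lambda>_. 0), rreg = (\<lambda>_. 0)\<rparr> n s \<and> rreg s 0 = v \<and> n \<le> k)"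

definition presorted :: "nat \<Rightarrow> (nat \<Rightarrow> real) \<Rightarrow> (nat \<Rightarrow> nat) \<Rightarrow> bool" where
  "presorted m T \<sigma> \<longleftrightarrow>
     bij_betw \<sigma> {1..m} {1..m} \<and> (\<forall>i\<in>{1..m}. \<forall>j\<in>{i..m}. T (\<sigma> j) \<le> T (\<sigma> i))"

definition test_input ::
  "nat \<Rightarrow> (nat \<Rightarrow> real) \<Rightarrow> (nat \<Rightarrow> nat) \<Rightarrow> nat set \<Rightarrow> (real \<Rightarrow> real) \<Rightarrow> (nat \<Rightarrow> real \<Rightarrow> ereal) \<Rightarrow>
    input" where
  "test_input m T \<sigma> S h C =
     \<lparr>num_hyps = m, score = T, sorted_index = \<sigma>, members = S, h_fun = h,
      crit_inf = (\<lambda>s q. unit_Inf {\<alpha>\<in>{0..1}. ereal q \<le> C s \<alpha>})\<rparr>"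

end

theory Submission
  imports Defs
begin

text \<open>
  At any level, enlarging the sum of an index set without changing its size can only lose the
  rejection. Among the supersets of \<open>S\<close> with \<open>i\<close> additional elements, the one that adds the \<open>i\<close>
  largest scores has the largest sum, because \<open>h\<close> is increasing; hence it has the largest
  \<open>p\<close>-value (\<open>adj_pvalue_upper_set\<close>). On the other hand, a given set is rejected at
  exactly those levels in the unit interval that are at least some threshold. The closed test
  rejects when the level reaches the thresholds of all supersets of \<open>S\<close>, so that its adjusted
  \<open>p\<close>-value is the maximum of their \<open>p\<close>-values (\<open>adj_pvalue_closed_test\<close>). Together, in the
  form of \<open>adj_pvalue_closed_test_eq_Max\<close>: the maximum may be taken over any family of supersets
  that contains, for each size, one that consists of \<open>S\<close> and of largest scores outside \<open>S\<close>.

  For the running time, the family used is \<open>S \<union> \<sigma> ` {1..k}\<close> for \<open>k \<le> m\<close>, where \<open>\<sigma>\<close> is the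
  given order of decreasing scores. Each of its members arises from the preceding one by adding at
  most one index, so that size and sum can be updated in constant time, and a single scan along
  \<open>\<sigma>\<close> computes the maximum. The sets in this family may differ from the sets \<open>S \<union> J i\<close>
  in how ties are broken, and some of them repeat; both maxima are nevertheless the
  adjusted \<open>p\<close>-value of the closed test, so they agree.
\<close>

section \<open>Adjusted p-values of closed tests\<close>

lemma unit_Inf_levels: "unit_Inf {\<alpha>\<in>{0..1}. c \<le> \<alpha>} = max 0 (min 1 c)" for c :: real
proof (cases "c \<le> 1")
  case True
  then have "{\<alpha>\<in>{0..1}. c \<le> \<alpha>} = {max 0 c..1}" by auto
  then show ?thesis using True by (simp add: unit_Inf_def)
next
  case False
  then have "{\<alpha>\<in>{0..1}. c \<le> \<alpha>} = {}" by auto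
  then show ?thesis using False by (simp add: unit_Inf_def)
qed

lemma unit_Inf_antimono:
  assumes "A \<subseteq> B" "B \<subseteq> {0..1}"
  shows "unit_Inf B \<le> unit_Inf A"
proof -
  have bdd: "bdd_below B" using assms(2) by (meson bdd_below_Icc bdd_below_mono)
  show ?thesis
  proof (cases "A = {}")
    case True
    show ?thesis
    proof (cases "B = {}")
      case False
      then obtain b where "b \<in> B" by blast
      then have "Inf B \<le> 1" using assms(2) bdd by (meson atLeastAtMost_iff cInf_lower2 subsetD)
      then show ?thesis using True False by (simp add: unit_Inf_def)
    qed (simp add: True)
  next
    case False
    then show ?thesis using assms bdd by (auto simp: unit_Inf_def intro: cInf_superset_mono)
  qed
qed

lemma adj_pvalue_mono:
  assumes "\<And>\<alpha>. \<alpha> \<in> {0..1} \<Longrightarrow> t \<alpha> K = 1 \<Longrightarrow> t \<alpha> J = 1"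
  shows "adj_pvalue t J \<le> adj_pvalue t K"
  unfolding adj_pvalue_def by (rule unit_Inf_antimono) (use assms in auto)

text \<open>
  The rejection levels of each set \<open>J\<close> have the form \<open>c J \<le> \<alpha>\<close>, so those of the closed
  test are given by the threshold \<open>Max c\<close>, and truncation to the unit interval commutes with
  maxima.
\<close>

lemma adj_pvalue_closed_test:
  assumes "local_tests m T t" and S: "S \<subseteq> {1..m}"
  shows "adj_pvalue (closed_test m t) S = Max (adj_pvalue t ` {J. S \<subseteq> J \<and> J \<subseteq> {1..m}})"
proof -
  let ?F = "{J. S \<subseteq> J \<and> J \<subseteq> {1..m}}"
  have fin: "finite ?F" by (rule finite_subset[of _ "Pow {1..m}"]) auto
  have ne: "?F \<noteq> {}" using S by auto
  obtain f :: "nat \<Rightarrow> (nat \<Rightarrow> real) \<Rightarrow> real" where f: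
    "\<forall>S\<subseteq>{1..m}. \<forall>\<alpha>\<in>{0..1}. t \<alpha> S = of_bool (f (card S) (restrict T S) \<le> \<alpha>)"
    using assms(1) by (auto simp: local_tests_def)
  define c where "c J = f (card J) (restrict T J)" for J
  have c: "t \<alpha> J = 1 \<longleftrightarrow> c J \<le> \<alpha>" if "J \<subseteq> {1..m}" "\<alpha> \<in> {0..1}" for \<alpha> J
    using f that by (simp add: c_def)
  have p: "adj_pvalue t J = max 0 (min 1 (c J))" if "J \<subseteq> {1..m}" for J
  proof -
    have "{\<alpha>\<in>{0..1}. t \<alpha> J = 1} = {\<alpha>\<in>{0..1}. c J \<le> \<alpha>}" using c that by auto
    then show ?thesis by (simp only: adj_pvalue_def unit_Inf_levels)
  qed
  have "{\<alpha>\<in>{0..1}. closed_test m t \<alpha> S = 1} = {\<alpha>\<in>{0..1}. \<forall>J\<in>?F. c J \<le> \<alpha>}"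
    using c by (auto simp: closed_test_def)
  also have "\<dots> = {\<alpha>\<in>{0..1}. Max (c ` ?F) \<le> \<alpha>}"
    using fin ne by simp
  finally have "adj_pvalue (closed_test m t) S = max 0 (min 1 (Max (c ` ?F)))"
    unfolding adj_pvalue_def by (simp only: unit_Inf_levels)
  also have "\<dots> = Max ((\<lambda>x. max 0 (min 1 x)) ` c ` ?F)"
    by (rule mono_Max_commute) (use fin ne in \<open>auto simp: mono_def\<close>)
  also have "(\<lambda>x. max 0 (min 1 x)) ` c ` ?F = adj_pvalue t ` ?F"
    unfolding image_image by (rule image_cong) (auto simp: p)
  finally show ?thesis .
qed

section \<open>Reduction to the largest scores\<close>

text \<open>Exchange: the two differences \<open>K - U\<close> and \<open>U - K\<close> are equinumerous.\<close>

lemma sum_le_sum_upper_set: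
  fixes g :: "'a \<Rightarrow> real"
  assumes fin: "finite A" and "K \<subseteq> A" "U \<subseteq> A" and card: "card K = card U"
    and upper: "\<And>a b. a \<in> U \<Longrightarrow> b \<in> A - U \<Longrightarrow> g b \<le> g a"
  shows "sum g K \<le> sum g U"
proof -
  have finK: "finite K" "finite U" using assms finite_subset by blast+
  have "card (K - U) = card (U - K)"
    using finK card by (simp add: card_Diff_subset_Int Int_commute)
  then obtain b where b: "bij_betw b (K - U) (U - K)"
    using finK by (metis finite_Diff finite_same_card_bij)
  have "sum g (K - U) \<le> (\<Sum>x\<in>K - U. g (b x))"
    by (rule sum_mono) (use b upper assms(2) in \<open>auto dest!: bij_betwE\<close>)
  also have "\<dots> = sum g (U - K)" by (rule sum.reindex_bij_betw[OF b])
  finally have "sum g (K \<inter> U) + sum g (K - U) \<le> sum g (U \<inter> K) + sum g (U - K)"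
    by (simp add: Int_commute)
  then show ?thesis using finK by (metis sum.Int_Diff)
qed

text \<open>
  Both sets have the same size, hence the same critical values, and \<open>S \<union> U\<close> has the larger sum:
  whenever it is rejected, so is \<open>J\<close>. The index set \<open>U\<close> is only required to be closed
  upwards in the score, which covers every way of breaking ties.
\<close>

lemma adj_pvalue_upper_set:
  assumes tests: "sum_local_tests m D T h C t" and SJ: "S \<subseteq> J" "J \<subseteq> {1..m}"
    and U: "U \<subseteq> {1..m} - S" and card: "card U = card (J - S)"
    and upper: "\<And>a b. a \<in> U \<Longrightarrow> b \<in> {1..m} - S - U \<Longrightarrow> T b \<le> T a"
  shows "adj_pvalue t J \<le> adj_pvalue t (S \<union> U)"
proof (cases "J = {}")
  \<comment> \<open>The empty set is not subject to the sum form, but here \<open>S \<union> U\<close> is empty too.\<close>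
  case True
  moreover have "finite U" using U by (rule finite_subset) simp
  ultimately have "U = {}" using card by simp
  then show ?thesis using True SJ by simp
next
  case False
  have fin: "finite S" "finite J" "finite U"
    using SJ U by (meson finite_subset finite_atLeastAtMost finite_Diff)+
  have D: "\<And>i. i \<in> {1..m} \<Longrightarrow> T i \<in> D" and mono: "mono_on D h"
    using tests by (auto simp: sum_local_tests_def)
  have J: "S \<union> (J - S) = J" using SJ by auto
  have "sum (\<lambda>i. h (T i)) (J - S) \<le> sum (\<lambda>i. h (T i)) U"
  proof (rule sum_le_sum_upper_set[of "{1..m} - S"])
    fix a b assume "a \<in> U" "b \<in> {1..m} - S - U"
    then show "h (T b) \<le> h (T a)"
      using U D upper by (intro mono_onD[OF mono]) auto
  qed (use SJ U card in auto)
  moreover have "sum (\<lambda>i. h (T i)) (S \<union> (J - S)) =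
      sum (\<lambda>i. h (T i)) S + sum (\<lambda>i. h (T i)) (J - S)"
    by (rule sum.union_disjoint) (use fin in auto)
  moreover have "sum (\<lambda>i. h (T i)) (S \<union> U) = sum (\<lambda>i. h (T i)) S + sum (\<lambda>i. h (T i)) U"
    by (rule sum.union_disjoint) (use fin U in auto)
  ultimately have le: "(\<Sum>i\<in>J. h (T i)) \<le> (\<Sum>i\<in>S \<union> U. h (T i))"
    by (simp only: J)
  have "card (S \<union> U) = card S + card (J - S)"
    using fin U card by (subst card_Un_disjoint) auto
  also have "\<dots> = card (S \<union> (J - S))" using fin by (subst card_Un_disjoint) auto
  finally have card': "card (S \<union> U) = card J" by (simp only: J)
  then have ne: "S \<union> U \<noteq> {}" using False fin by (metis card_0_eq card.empty)
  have sub: "S \<union> U \<subseteq> {1..m}" using SJ U by auto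
  have form: "t \<alpha> K = 1 \<longleftrightarrow> ereal (\<Sum>i\<in>K. h (T i)) \<le> C (card K) \<alpha>"
    if "\<alpha> \<in> {0..1}" "K \<subseteq> {1..m}" "K \<noteq> {}" for \<alpha> K
    using tests that by (simp add: sum_local_tests_def)
  show ?thesis
  proof (rule adj_pvalue_mono)
    fix \<alpha> :: real assume "\<alpha> \<in> {0..1}" "t \<alpha> (S \<union> U) = 1"
    then have "ereal (\<Sum>i\<in>S \<union> U. h (T i)) \<le> C (card J) \<alpha>"
      using form[OF _ sub ne] card' by simp
    then have "ereal (\<Sum>i\<in>J. h (T i)) \<le> C (card J) \<alpha>"
      using le by (meson ereal_less_eq(3) order_trans)
    then show "t \<alpha> J = 1" using form SJ(2) False \<open>\<alpha> \<in> {0..1}\<close> by simp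
  qed
qed

lemma adj_pvalue_closed_test_eq_Max:
  assumes tests: "sum_local_tests m D T h C t" and S: "S \<subseteq> {1..m}"
    and N: "\<And>k. k \<in> N \<Longrightarrow> U k \<subseteq> {1..m} - S" "finite N"
    and upper: "\<And>k a b. k \<in> N \<Longrightarrow> a \<in> U k \<Longrightarrow> b \<in> {1..m} - S - U k \<Longrightarrow> T b \<le> T a"
    and sizes: "\<And>i. i \<le> card ({1..m} - S) \<Longrightarrow> \<exists>k\<in>N. card (U k) = i"
  shows "adj_pvalue (closed_test m t) S = (MAX k\<in>N. adj_pvalue t (S \<union> U k))"
proof -
  let ?F = "{J. S \<subseteq> J \<and> J \<subseteq> {1..m}}"
  have fin: "finite ?F" by (rule finite_subset[of _ "Pow {1..m}"]) auto
  have "Max (adj_pvalue t ` ?F) = (MAX k\<in>N. adj_pvalue t (S \<union> U k))"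
  proof (rule antisym)
    show "Max (adj_pvalue t ` ?F) \<le> (MAX k\<in>N. adj_pvalue t (S \<union> U k))"
    proof (rule Max.boundedI)
      fix x assume "x \<in> adj_pvalue t ` ?F"
      then obtain J where J: "S \<subseteq> J" "J \<subseteq> {1..m}" "x = adj_pvalue t J" by auto
      have "card (J - S) \<le> card ({1..m} - S)" using J by (intro card_mono) auto
      then obtain k where k: "k \<in> N" "card (U k) = card (J - S)" using sizes by blast
      have "x \<le> adj_pvalue t (S \<union> U k)"
        unfolding J(3)
        by (rule adj_pvalue_upper_set[OF tests J(1,2) N(1)[OF k(1)] k(2) upper[OF k(1)]])
      also have "\<dots> \<le> (MAX k\<in>N. adj_pvalue t (S \<union> U k))"
        using N(2) k by (intro Max_ge) auto
      finally show "x \<le> (MAX k\<in>N. adj_pvalue t (S \<union> U k))" .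
    qed (use fin S in auto)
    show "(MAX k\<in>N. adj_pvalue t (S \<union> U k)) \<le> Max (adj_pvalue t ` ?F)"
    proof (rule Max_mono)
      show "(\<lambda>k. adj_pvalue t (S \<union> U k)) ` N \<subseteq> adj_pvalue t ` ?F"
        using N S by fast
    qed (use fin sizes[of 0] in auto)
  qed
  then show ?thesis
    using adj_pvalue_closed_test[OF _ S, of T t] tests by (simp add: sum_local_tests_def)
qed

corollary adj_pvalue_closed_test_top_scores:
  assumes "sum_local_tests m D T h C t" "S \<subseteq> {1..m}" "top_scores m T S J"
  shows "adj_pvalue (closed_test m t) S =
    (MAX i\<in>{0..card ({1..m} - S)}. adj_pvalue t (S \<union> J i))"
  by (rule adj_pvalue_closed_test_eq_Max[OF assms(1,2)])
    (use assms(3) in \<open>auto simp: top_scores_def\<close>)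

text \<open>
  Along the sorted indices, the number of indices outside \<open>S\<close> grows from \<open>0\<close> to its final value
  in steps of at most one, so that each size occurs.
\<close>

lemma sorted_prefix_sizes:
  fixes m :: nat
  assumes "i \<le> card (\<sigma> ` {1..m} - S)"
  shows "\<exists>k\<in>{0..m}. card (\<sigma> ` {1..k} - S) = i"
  using assms
proof (induction m)
  case 0
  then show ?case by auto
next
  case (Suc m)
  show ?case
  proof (cases "i \<le> card (\<sigma> ` {1..m} - S)")
    case True
    from Suc.IH[OF this] show ?thesis by fastforce
  next
    case False
    have "card (\<sigma> ` {1..Suc m} - S) \<le> card (insert (\<sigma> (Suc m)) (\<sigma> ` {1..m} - S))"
      by (rule card_mono) (auto simp: atLeastAtMostSuc_conv)
    also have "\<dots> \<le> Suc (card (\<sigma> ` {1..m} - S))" by (rule card_insert_le_m1) auto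
    finally have "card (\<sigma> ` {1..Suc m} - S) = i" using False Suc.prems by linarith
    then show ?thesis by auto
  qed
qed

corollary adj_pvalue_closed_test_presorted:
  assumes "sum_local_tests m D T h C t" "S \<subseteq> {1..m}" "presorted m T \<sigma>"
  shows "adj_pvalue (closed_test m t) S = (MAX k\<in>{0..m}. adj_pvalue t (S \<union> \<sigma> ` {1..k}))"
proof -
  have img: "\<sigma> ` {1..m} = {1..m}"
    using assms(3) by (simp add: presorted_def bij_betw_def)
  have sorted: "T (\<sigma> j) \<le> T (\<sigma> i)" if "1 \<le> i" "i \<le> j" "j \<le> m" for i j
    using assms(3) that by (auto simp: presorted_def)
  have "adj_pvalue (closed_test m t) S =
      (MAX k\<in>{0..m}. adj_pvalue t (S \<union> (\<sigma> ` {1..k} - S)))"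
  proof (rule adj_pvalue_closed_test_eq_Max[OF assms(1,2)])
    fix k a b
    assume "k \<in> {0..m}" "a \<in> \<sigma> ` {1..k} - S" "b \<in> {1..m} - S - (\<sigma> ` {1..k} - S)"
    moreover from this have "b \<in> \<sigma> ` {1..m}" using img by auto
    ultimately obtain i j where "a = \<sigma> i" "1 \<le> i" "i \<le> k" "b = \<sigma> j" "j \<le> m" "\<not> j \<le> k"
      by force
    then show "T b \<le> T a" using sorted by simp
  next
    fix k assume "k \<in> {0..m}"
    then have "\<sigma> ` {1..k} \<subseteq> \<sigma> ` {1..m}" by (intro image_mono) auto
    then show "\<sigma> ` {1..k} - S \<subseteq> {1..m} - S" using img by auto
  next
    fix i assume "i \<le> card ({1..m} - S)"
    then show "\<exists>k\<in>{0..m}. card (\<sigma> ` {1..k} - S) = i"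
      by (intro sorted_prefix_sizes) (simp only: img)
  qed simp
  then show ?thesis by (simp add: Un_Diff_cancel)
qed

section \<open>Weakest preconditions with running times\<close>

text \<open>
  The postcondition receives the number of elementary operations along with the final state. For
  programs without loops, the equations below turn a claim about an execution into a claim about
  explicit states.
\<close>

definition wp :: "input \<Rightarrow> program \<Rightarrow> (nat \<Rightarrow> state \<Rightarrow> bool) \<Rightarrow> state \<Rightarrow> bool" where
  "wp I c Q s \<longleftrightarrow> (\<exists>n s'. exec I c s n s' \<and> Q n s')"

lemma wp_Skip [simp]: "wp I Skip Q s \<longleftrightarrow> Q 1 s"
  unfolding wp_def by (metis exec.Skip exec_deterministic)

lemma wp_Do [simp]: "wp I (Do i) Q s \<longleftrightarrow> Q 1 (run_instr I i s)"
  unfolding wp_def by (metis exec.Do exec_deterministic)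

lemma wp_Seq [simp]:
  "wp I (Seq c1 c2) Q s \<longleftrightarrow> wp I c1 (\<lambda>n1. wp I c2 (\<lambda>n2. Q (n1 + n2))) s"
  (is "?L \<longleftrightarrow> ?R")
proof
  assume ?L
  then obtain n s' where "exec I (Seq c1 c2) s n s'" and Q: "Q n s'" by (auto simp: wp_def)
  from this(1) show ?R by cases (use Q in \<open>auto simp: wp_def\<close>)
qed (auto simp: wp_def intro: exec.Seq)

lemma wp_Cond [simp]:
  "wp I (Cond b c1 c2) Q s \<longleftrightarrow>
    (if run_test I b s then wp I c1 (\<lambda>n. Q (1 + n)) s else wp I c2 (\<lambda>n. Q (1 + n)) s)"
  (is "?L \<longleftrightarrow> ?R")
proof
  assume ?L
  then obtain n s' where "exec I (Cond b c1 c2) s n s'" and Q: "Q n s'" by (auto simp: wp_def)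
  from this(1) show ?R by cases (use Q in \<open>auto simp: wp_def\<close>)
next
  assume ?R
  then show ?L
    unfolding wp_def by (metis exec.CondTrue exec.CondFalse)
qed

lemma wp_mono: "wp I c Q s \<Longrightarrow> (\<And>n s'. Q n s' \<Longrightarrow> Q' n s') \<Longrightarrow> wp I c Q' s"
  unfolding wp_def by blast

lemma wp_While_count:
  assumes step: "\<And>i s. i < N \<Longrightarrow> Inv i s \<Longrightarrow>
      run_test I b s \<and> wp I c (\<lambda>n s'. n \<le> k \<and> Inv (Suc i) s') s"
    and stop: "\<And>s. Inv N s \<Longrightarrow> \<not> run_test I b s"
    and init: "Inv 0 s"
  shows "wp I (While b c) (\<lambda>n s'. n \<le> N * (k + 1) + 1 \<and> Inv N s') s"
proof -
  have "wp I (While b c) (\<lambda>n s'. n \<le> (N - i) * (k + 1) + 1 \<and> Inv N s') s"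
    if "i \<le> N" "Inv i s" for i s
    using that
  proof (induction arbitrary: s rule: inc_induct)
    case base
    then show ?case using stop exec.WhileFalse by (fastforce simp: wp_def)
  next
    case (step i)
    from assms(1)[OF step.hyps(2) step.prems] obtain n1 s1 where
      1: "run_test I b s" "exec I c s n1 s1" "n1 \<le> k" "Inv (Suc i) s1" by (auto simp: wp_def)
    from step.IH[OF 1(4)] obtain n2 s2 where
      2: "exec I (While b c) s1 n2 s2" "n2 \<le> (N - Suc i) * (k + 1) + 1" "Inv N s2"
      by (auto simp: wp_def)
    have "N - i = Suc (N - Suc i)" using step.hyps by simp
    then have "1 + n1 + n2 \<le> (N - i) * (k + 1) + 1" using 1 2 by simp
    then show ?case using exec.WhileTrue[OF 1(1,2) 2(1)] 2(3) by (auto simp: wp_def)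
  qed
  from this[of 0] init show ?thesis by simp
qed

section \<open>The linear-time program\<close>

text \<open>
  Registers for natural numbers: 1 holds \<open>m\<close>, 2 the constant one, 3 the loop counter, 4 the size of
  the current set, 5 stays zero, 6 the index under consideration. Registers for real numbers:
  0 holds the maximum so far, 1 a score and its image under \<open>h\<close>, 3 the sum over the
  current set, 4 its \<open>p\<close>-value, 5 stays zero. The machine has no copy instruction, whence the
  addition of zero.
\<close>

definition add_index :: "reg \<Rightarrow> program" where
  "add_index x =
    Seq (Do (ReadScore 1 x)) (Seq (Do (CallH 1 1)) (Seq (Do (RAdd 3 3 1)) (Do (NAdd 4 4 2))))"

definition scan_members :: program where
  "scan_members =
    While (NLess 3 1) (Seq (Do (NAdd 3 3 2)) (Cond (Member 3) (add_index 3) Skip))"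

definition scan_sorted :: program where
  "scan_sorted =
    While (NLess 3 1)
      (Seq (Do (NAdd 3 3 2)) (Seq (Do (ReadIndex 6 3))
        (Cond (Member 6) Skip
          (Seq (add_index 6) (Seq (Do (CallCrit 4 4 3))
            (Cond (RLess 0 4) (Do (RAdd 0 4 5)) Skip))))))"

text \<open>
  The \<open>p\<close>-value of the empty set is 1 and not subject to the sum form. If \<open>S\<close> is empty, then this
  value is the maximum.
\<close>

definition closed_pvalue_program :: program where
  "closed_pvalue_program =
    Seq (Do (ReadNum 1)) (Seq (Do (NConst 2 1)) (Seq scan_members
      (Cond (NLess 5 4)
        (Seq (Do (CallCrit 0 4 3)) (Seq (Do (NConst 3 0)) scan_sorted))
        (Do (RConst 0 1)))))"

lemma wp_scan_members:
  assumes m: "num_hyps I = m"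
    and s: "nreg s 1 = m" "nreg s 2 = 1" "nreg s 3 = 0" "nreg s 4 = 0" "nreg s 5 = 0"
      "rreg s 3 = 0" "rreg s 5 = 0"
  shows "wp I scan_members (\<lambda>n s'. n \<le> m * 7 + 1 \<and>
    nreg s' 1 = m \<and> nreg s' 2 = 1 \<and> nreg s' 5 = 0 \<and> rreg s' 5 = 0 \<and>
    nreg s' 4 = card (members I \<inter> {1..m}) \<and>
    rreg s' 3 = (\<Sum>i\<in>members I \<inter> {1..m}. h_fun I (score I i))) s"
proof -
  define Inv where "Inv i s' \<longleftrightarrow>
    nreg s' 1 = m \<and> nreg s' 2 = 1 \<and> nreg s' 3 = i \<and> nreg s' 5 = 0 \<and> rreg s' 5 = 0 \<and>
    nreg s' 4 = card (members I \<inter> {1..i}) \<and>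
    rreg s' 3 = (\<Sum>i\<in>members I \<inter> {1..i}. h_fun I (score I i))" for i and s' :: state
  have "wp I scan_members (\<lambda>n s'. n \<le> m * (6 + 1) + 1 \<and> Inv m s') s"
    unfolding scan_members_def
  proof (rule wp_While_count)
    fix i s assume "i < m" "Inv i s"
    moreover have "members I \<inter> {1..Suc i} =
        (if Suc i \<in> members I then insert (Suc i) (members I \<inter> {1..i}) else members I \<inter> {1..i})"
      by (auto simp: atLeastAtMostSuc_conv)
    ultimately show "run_test I (NLess 3 1) s \<and>
        wp I (Seq (Do (NAdd 3 3 2)) (Cond (Member 3) (add_index 3) Skip))
          (\<lambda>n s'. n \<le> 6 \<and> Inv (Suc i) s') s"
      by (auto simp: Inv_def add_index_def set_nreg_def set_rreg_def)
  qed (use s in \<open>auto simp: Inv_def\<close>)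
  then show ?thesis by (rule wp_mono) (auto simp: Inv_def)
qed

text \<open>
  An index that already belongs to the current set leaves it unchanged, so that skipping it
  maintains the maximum over all prefixes. Injectivity of the order guarantees that no score is added
  twice.
\<close>

lemma wp_scan_sorted:
  fixes I :: input
  defines "A k \<equiv> members I \<union> sorted_index I ` {1..k}"
  defines "p k \<equiv> crit_inf I (card (A k)) (\<Sum>i\<in>A k. h_fun I (score I i))"
  assumes fin: "finite (members I)"
    and inj: "inj_on (sorted_index I) {1..m}"
    and s: "nreg s 1 = m" "nreg s 2 = 1" "nreg s 3 = 0" "rreg s 5 = 0"
      "nreg s 4 = card (A 0)" "rreg s 3 = (\<Sum>i\<in>A 0. h_fun I (score I i))" "rreg s 0 = p 0"
  shows "wp I scan_sorted (\<lambda>n s'. n \<le> m * 12 + 1 \<and> rreg s' 0 = (MAX k\<in>{0..m}. p k)) s"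
proof -
  define q where "q i = (MAX k\<in>{0..i}. p k)" for i
  define Inv where "Inv i s' \<longleftrightarrow>
    nreg s' 1 = m \<and> nreg s' 2 = 1 \<and> nreg s' 3 = i \<and> rreg s' 5 = 0 \<and>
    nreg s' 4 = card (A i) \<and> rreg s' 3 = (\<Sum>i\<in>A i. h_fun I (score I i)) \<and>
    rreg s' 0 = q i" for i and s' :: state
  have "wp I scan_sorted (\<lambda>n s'. n \<le> m * (11 + 1) + 1 \<and> Inv m s') s"
    unfolding scan_sorted_def
  proof (rule wp_While_count)
    fix i s assume i: "i < m" and inv: "Inv i s"
    have A: "A (Suc i) = insert (sorted_index I (Suc i)) (A i)"
      by (auto simp: A_def atLeastAtMostSuc_conv)
    have finA: "finite (A i)" using fin by (simp add: A_def)
    have "{0..Suc i} = insert (Suc i) {0..i}" by auto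
    then have M: "q (Suc i) = max (p (Suc i)) (q i)" by (simp add: q_def)
    show "run_test I (NLess 3 1) s \<and>
        wp I (Seq (Do (NAdd 3 3 2)) (Seq (Do (ReadIndex 6 3))
          (Cond (Member 6) Skip
            (Seq (add_index 6) (Seq (Do (CallCrit 4 4 3))
              (Cond (RLess 0 4) (Do (RAdd 0 4 5)) Skip))))))
          (\<lambda>n s'. n \<le> 11 \<and> Inv (Suc i) s') s"
    proof (cases "sorted_index I (Suc i) \<in> members I")
      case True
      then have A': "A (Suc i) = A i" unfolding A by (auto simp: A_def)
      then have "p (Suc i) = p i" by (simp add: p_def)
      moreover have "p i \<le> q i" unfolding q_def by (intro Max_ge) auto
      ultimately have "q (Suc i) = q i" unfolding M by simp
      then show ?thesis using i inv True A'
        by (simp add: Inv_def set_nreg_def set_rreg_def)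
    next
      case False
      have "sorted_index I (Suc i) \<notin> sorted_index I ` {1..i}"
        using inj_onD[OF inj, of "Suc i"] i by fastforce
      then have "sorted_index I (Suc i) \<notin> A i" using False by (simp add: A_def)
      then have "card (A (Suc i)) = card (A i) + 1"
        "(\<Sum>i\<in>A (Suc i). h_fun I (score I i)) =
          (\<Sum>i\<in>A i. h_fun I (score I i)) + h_fun I (score I (sorted_index I (Suc i)))"
        unfolding A using finA by simp_all
      then show ?thesis using i inv False M p_def[of "Suc i"]
        by (simp add: Inv_def add_index_def set_nreg_def set_rreg_def)
    qed
  qed (use s in \<open>auto simp: Inv_def q_def\<close>)
  then show ?thesis by (rule wp_mono) (auto simp: Inv_def q_def)
qed

lemma adj_pvalue_eq_crit_inf:
  assumes "sum_local_tests m D T h C t" "K \<subseteq> {1..m}" "K \<noteq> {}"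
  shows "adj_pvalue t K = crit_inf (test_input m T \<sigma> S h C) (card K) (\<Sum>i\<in>K. h (T i))"
proof -
  have "t \<alpha> K = 1 \<longleftrightarrow> ereal (\<Sum>i\<in>K. h (T i)) \<le> C (card K) \<alpha>"
    if "\<alpha> \<in> {0..1}" for \<alpha>
    using assms that by (simp add: sum_local_tests_def)
  then have "{\<alpha>\<in>{0..1}. t \<alpha> K = 1} = {\<alpha>\<in>{0..1}. ereal (\<Sum>i\<in>K. h (T i)) \<le> C (card K) \<alpha>}"
    by (intro Collect_cong) auto
  then show ?thesis by (simp add: adj_pvalue_def test_input_def)
qed

lemma adj_pvalue_closed_test_empty:
  assumes "local_tests m T t"
  shows "adj_pvalue (closed_test m t) {} = 1"
proof -
  have "t \<alpha> {} \<noteq> 1" if "\<alpha> \<in> {0..1}" for \<alpha> using assms that by (simp add: local_tests_def)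
  then have "{\<alpha>\<in>{0..1}. closed_test m t \<alpha> {} = 1} = {}"
    by (auto simp: closed_test_def)
  then show ?thesis by (simp only: adj_pvalue_def unit_Inf_def simp_thms if_True)
qed

text \<open>
  An iteration of the first loop takes at most 7 operations, including its test, and one of the
  second loop at most 12.
\<close>

theorem closed_pvalue_program_correct:
  assumes tests: "sum_local_tests m D T h C t" and S: "S \<subseteq> {1..m}" and \<sigma>: "presorted m T \<sigma>"
  shows "computes_within closed_pvalue_program (test_input m T \<sigma> S h C)
    (adj_pvalue (closed_test m t) S) (19 * m + 7)"
proof -
  define I where "I = test_input m T \<sigma> S h C"
  have I: "num_hyps I = m" "members I = S" "sorted_index I = \<sigma>" "h_fun I = h" "score I = T"
    by (simp_all add: I_def test_input_def)
  have fin: "finite S" using S finite_subset by blast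
  have inj: "inj_on \<sigma> {1..m}" and img: "\<sigma> ` {1..m} = {1..m}"
    using \<sigma> by (auto simp: presorted_def bij_betw_def)
  let ?p = "adj_pvalue (closed_test m t) S"
  let ?s0 = "\<lparr>nreg = (\<lambda>_. 0), rreg = (\<lambda>_. 0)\<rparr>"
  let ?tail = "Cond (NLess 5 4)
    (Seq (Do (CallCrit 0 4 3)) (Seq (Do (NConst 3 0)) scan_sorted)) (Do (RConst 0 1))"
  have tail: "wp I ?tail (\<lambda>n s'. n \<le> m * 12 + 4 \<and> rreg s' 0 = ?p) s"
    if s: "nreg s 1 = m" "nreg s 2 = 1" "nreg s 5 = 0" "rreg s 5 = 0" "nreg s 4 = card S"
      "rreg s 3 = (\<Sum>i\<in>S. h (T i))" for s
  proof (cases "S = {}")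
    case True
    have "?p = 1"
      unfolding True by (rule adj_pvalue_closed_test_empty[of m T])
        (use tests in \<open>simp add: sum_local_tests_def\<close>)
    then show ?thesis using s True by (simp add: set_rreg_def)
  next
    case False
    then have pos: "0 < card S" using fin by (simp add: card_gt_0_iff)
    have "?p = (MAX k\<in>{0..m}. adj_pvalue t (S \<union> \<sigma> ` {1..k}))"
      by (rule adj_pvalue_closed_test_presorted[OF tests S \<sigma>])
    also have "(\<lambda>k. adj_pvalue t (S \<union> \<sigma> ` {1..k})) ` {0..m} =
        (\<lambda>k. crit_inf I (card (S \<union> \<sigma> ` {1..k})) (\<Sum>i\<in>S \<union> \<sigma> ` {1..k}. h (T i))) ` {0..m}"
    proof (rule image_cong[OF refl])
      fix k assume "k \<in> {0..m}"
      then have "\<sigma> ` {1..k} \<subseteq> \<sigma> ` {1..m}" by (intro image_mono) auto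
      then show "adj_pvalue t (S \<union> \<sigma> ` {1..k}) =
          crit_inf I (card (S \<union> \<sigma> ` {1..k})) (\<Sum>i\<in>S \<union> \<sigma> ` {1..k}. h (T i))"
        unfolding I_def using False S img
        by (intro adj_pvalue_eq_crit_inf[OF tests]) auto
    qed
    finally have p: "?p = (MAX k\<in>{0..m}.
      crit_inf I (card (S \<union> \<sigma> ` {1..k})) (\<Sum>i\<in>S \<union> \<sigma> ` {1..k}. h (T i)))" .
    let ?s = "set_nreg 3 0 (set_rreg 0 (crit_inf I (card S) (\<Sum>i\<in>S. h (T i))) s)"
    have "wp I scan_sorted (\<lambda>n s'. n \<le> m * 12 + 1 \<and> rreg s' 0 = ?p) ?s"
      using wp_scan_sorted[of I m ?s] fin inj s
      unfolding p I by (simp add: set_nreg_def set_rreg_def)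
    then show ?thesis using s pos by (auto elim: wp_mono)
  qed
  have "wp I closed_pvalue_program (\<lambda>n s'. n \<le> 19 * m + 7 \<and> rreg s' 0 = ?p) ?s0"
  proof -
    let ?s = "set_nreg 2 1 (set_nreg 1 m ?s0)"
    have "wp I scan_members (\<lambda>n s'. n \<le> m * 7 + 1 \<and>
      nreg s' 1 = m \<and> nreg s' 2 = 1 \<and> nreg s' 5 = 0 \<and> rreg s' 5 = 0 \<and>
      nreg s' 4 = card S \<and> rreg s' 3 = (\<Sum>i\<in>S. h (T i))) ?s"
      using wp_scan_members[of I m ?s] S
      by (simp add: I set_nreg_def Int_absorb2)
    then have "wp I (Seq scan_members ?tail)
        (\<lambda>n s'. n \<le> 19 * m + 5 \<and> rreg s' 0 = ?p) ?s"
      unfolding wp_Seq by (rule wp_mono) (rule wp_mono[OF tail]; simp)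
    then show ?thesis
      unfolding closed_pvalue_program_def by (auto simp: I elim!: wp_mono simp del: wp_Cond)
  qed
  then show ?thesis by (auto simp: computes_within_def wp_def I_def)
qed

theorem theorem1:
  shows
    "(\<forall>m D T h C t S J.
        sum_local_tests m D T h C t \<and> S \<subseteq> {1..m} \<and> top_scores m T S J \<longrightarrow>
          adj_pvalue (closed_test m t) S =
            (MAX i\<in>{0..card ({1..m} - S)}. adj_pvalue t (S \<union> J i))) \<and>
     (\<exists>(prog :: program) (time :: nat \<Rightarrow> nat).
        (\<lambda>m. real (time m)) \<in> O(\<lambda>m. real m) \<and>
        (\<forall>m D T h C t S J \<sigma>.
           sum_local_tests m D T h C t \<and> S \<subseteq> {1..m} \<and> top_scores m T S J \<and> presorted m T \<sigma> \<longrightarrow>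
             computes_within prog (test_input m T \<sigma> S h C)
               (MAX i\<in>{0..card ({1..m} - S)}. adj_pvalue t (S \<union> J i)) (time m)))"
proof (intro conjI exI[of _ closed_pvalue_program] exI[of _ "\<lambda>m. 19 * m + 7"])
  show "(\<lambda>m. real (19 * m + 7)) \<in> O(\<lambda>m. real m)"
    by (rule bigoI[of _ 26], rule eventually_sequentiallyI[of 1]) simp
qed (use adj_pvalue_closed_test_top_scores closed_pvalue_program_correct in metis)+

end
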